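(* Let $G\subset\mathbb{C}$ be non-empty and suppose that the block Jacobi parameters satisfy $$\liminf_{n\to+\infty}\frac1{\rho_n}\sum_{k=1}^n\|R_k(\lambda)\|^2<+\infty\quad\text{for all }\lambda\in G,\qquad \rho_n:=\sum_{k=0}^{n-1}\frac1{\|A_k\|}.$$ Then $J$ is self-adjoint if and only if the Carleman condition $\sum_{n=0}^{+\infty}\frac1{\|A_n\|}=\infty$ is satisfied.
   Context: Setting. Fix $d\in\mathbb{N}$, $d\ge 1$, and sequences $(A_n)_{n\ge 0}$, $(B_n)_{n\ge 0}$ of complex $d\times d$ matrices with $\det A_n\neq 0$ and $B_n=B_n^*$ for all $n\ge 0$ (the block Jacobi parameters). Put $A_{-1}:=-\operatorname{I}$. For a sequence $u=(u_n)_{n\ge0}$ in $\mathbb{C}^d$ set $(\mathcal{J}u)_0=B_0u_0+A_0u_1$ and $(\mathcal{J}u)_n=A_{n-1}^*u_{n-1}+B_nu_n+A_nu_{n+1}$ for $n\ge1$. The (maximal) block Jacobi operator $J$ in $\ell^2(\mathbb{N}_0,\mathbb{C}^d)$ is the restriction of $\mathcal{J}$ to $\operatorname{Dom}(J)=\{u\in\ell^2(\mathbb{N}_0,\mathbb{C}^d):\mathcal{J}u\in\ell^2(\mathbb{N}_0,\mathbb{C}^d)\}$. Transfer matrices. For $z\in\mathbb{C}$ and $n\ge0$, $T_n(z)=\begin{pmatrix}0&\operatorname{I}\\-A_n^{-1}A_{n-1}^*&A_n^{-1}(z\operatorname{I}-B_n)\end{pmatrix}$ (a $2d\times2d$ matrix),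 and $R_n(z)=T_{n-1}(z)\cdots T_0(z)$ for $n\ge1$. Matrix norms are operator norms for Euclidean norms. *)

theory Defs
  imports "HOL-Analysis.Analysis"
begin

section \<open>Matrices\<close>

definition conj_transpose :: "complex^'m^'n \<Rightarrow> complex^'n^'m" where
  "conj_transpose M = (\<chi> i j. cnj (M $ j $ i))"

text \<open>\<^term>\<open>norm\<close> on the type of matrices is the Frobenius norm; the operator norm for the
  Euclidean norms is the following one.\<close>

definition opnorm :: "complex^'m^'n \<Rightarrow> real" where
  "opnorm M = onorm (\<lambda>v. M *v v)"

definition block_matrix ::
  "complex^'d^'d \<Rightarrow> complex^'d^'d \<Rightarrow> complex^'d^'d \<Rightarrow> complex^'d^'d \<Rightarrow> complex^('d + 'd)^('d + 'd)" where
  "block_matrix P Q R S = (\<chi> i j.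
     (case i of
        Inl a \<Rightarrow> (case j of Inl b \<Rightarrow> P $ a $ b | Inr b \<Rightarrow> Q $ a $ b)
      | Inr a \<Rightarrow> (case j of Inl b \<Rightarrow> R $ a $ b | Inr b \<Rightarrow> S $ a $ b)))"

section \<open>Unbounded operators in the Hilbert space of square-summable sequences\<close>

definition ell2 :: "(nat \<Rightarrow> complex^'d) set" where
  "ell2 = {u. summable (\<lambda>n. (norm (u n))\<^sup>2)}"

definition ell2_norm :: "(nat \<Rightarrow> complex^'d) \<Rightarrow> real" where
  "ell2_norm u = sqrt (\<Sum>n. (norm (u n))\<^sup>2)"

text \<open>The library's \<open>\<bullet>\<close> on \<^typ>\<open>complex^'d\<close> is the real part of the Hermitian inner
  product, so the latter is written out.\<close>

definition ell2_inner :: "(nat \<Rightarrow> complex^'d) \<Rightarrow> (nat \<Rightarrow> complex^'d) \<Rightarrow> complex" where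
  "ell2_inner u v = (\<Sum>n. \<Sum>i\<in>UNIV. u n $ i * cnj (v n $ i))"

text \<open>An operator in \<^const>\<open>ell2\<close> is identified with its graph, the set of pairs
  \<open>(u, T u)\<close> with \<open>u\<close> in the domain of \<open>T\<close>. The adjoint of a densely defined operator is
  then single-valued, and equality of graphs means equality of domains and of values.\<close>

type_synonym 'd seq_operator = "((nat \<Rightarrow> complex^'d) \<times> (nat \<Rightarrow> complex^'d)) set"

definition densely_defined :: "'d::finite seq_operator \<Rightarrow> bool" where
  "densely_defined T \<longleftrightarrow>
     (\<forall>u\<in>ell2. \<forall>e>0. \<exists>v\<in>Domain T. ell2_norm (\<lambda>n. u n - v n) < e)"

definition adjoint_operator :: "'d::finite seq_operator \<Rightarrow> 'd seq_operator" where
  "adjoint_operator T = {(v, w). v \<in> ell2 \<and> w \<in> ell2 \<and>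
     (\<forall>(u, y)\<in>T. ell2_inner y v = ell2_inner u w)}"

definition self_adjoint :: "'d::finite seq_operator \<Rightarrow> bool" where
  "self_adjoint T \<longleftrightarrow> densely_defined T \<and> adjoint_operator T = T"

section \<open>Block Jacobi operators and transfer matrices\<close>

definition jacobi_expr ::
  "(nat \<Rightarrow> complex^'d^'d) \<Rightarrow> (nat \<Rightarrow> complex^'d^'d) \<Rightarrow> (nat \<Rightarrow> complex^'d) \<Rightarrow> nat \<Rightarrow> complex^'d" where
  "jacobi_expr A B u n = (case n of
     0 \<Rightarrow> B 0 *v u 0 + A 0 *v u 1
   | Suc m \<Rightarrow> conj_transpose (A m) *v u m + B n *v u n + A n *v u (n + 1))"

definition jacobi_operator ::
  "(nat \<Rightarrow> complex^'d^'d) \<Rightarrow> (nat \<Rightarrow> complex^'d^'d) \<Rightarrow> 'd::finite seq_operator" where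
  "jacobi_operator A B = {(u, jacobi_expr A B u) | u. u \<in> ell2 \<and> jacobi_expr A B u \<in> ell2}"

text \<open>\<open>A_pred A n\<close> is \<open>A\<close> at index \<open>n - 1\<close>, with the convention that \<open>A\<close> at index \<open>-1\<close> is
  minus the identity.\<close>

definition A_pred :: "(nat \<Rightarrow> complex^'d^'d) \<Rightarrow> nat \<Rightarrow> complex^'d^'d" where
  "A_pred A n = (case n of 0 \<Rightarrow> - mat 1 | Suc m \<Rightarrow> A m)"

definition transfer_matrix ::
  "(nat \<Rightarrow> complex^'d^'d) \<Rightarrow> (nat \<Rightarrow> complex^'d^'d) \<Rightarrow> nat \<Rightarrow> complex \<Rightarrow> complex^('d + 'd)^('d + 'd)" where
  "transfer_matrix A B n z = block_matrix
     0 (mat 1)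
     (- (matrix_inv (A n) ** conj_transpose (A_pred A n))) (matrix_inv (A n) ** (mat z - B n))"

primrec transfer_prod ::
  "(nat \<Rightarrow> complex^'d^'d) \<Rightarrow> (nat \<Rightarrow> complex^'d^'d) \<Rightarrow> nat \<Rightarrow> complex \<Rightarrow> complex^('d + 'd)^('d + 'd)" where
  "transfer_prod A B 0 z = mat 1"
| "transfer_prod A B (Suc n) z = transfer_matrix A B n z ** transfer_prod A B n z"

definition rho :: "(nat \<Rightarrow> complex^'d^'d) \<Rightarrow> nat \<Rightarrow> real" where
  "rho A n = (\<Sum>k<n. 1 / opnorm (A k))"

definition carleman :: "(nat \<Rightarrow> complex^'d^'d) \<Rightarrow> bool" where
  "carleman A \<longleftrightarrow> (\<Sum>n. ereal (1 / opnorm (A n))) = \<infinity>"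

end

theory Submission
  imports Defs
begin

text \<open>If \<open>J\<close> fails to be symmetric, Green's formula makes
  \<open>\<bar>\<langle>A\<^sub>n u\<^sub>n\<^sub>+\<^sub>1, v\<^sub>n\<rangle> - \<langle>u\<^sub>n, A\<^sub>n v\<^sub>n\<^sub>+\<^sub>1\<rangle>\<bar>\<close> converge
  to a nonzero limit for some \<open>u\<close>, \<open>v\<close> in the domain, so that \<open>1 / \<parallel>A\<^sub>n\<parallel>\<close> is dominated by a summable sequence; the inclusion of the adjoint in \<open>J\<close> is always
  true. Conversely, if \<open>\<rho>\<^sub>n\<close> is bounded, then the hypothesis at a single \<open>\<lambda> \<in> G\<close> makes
  \<open>\<parallel>R\<^sub>k(\<lambda>)\<parallel>\<^sup>2\<close> summable, and so all solutions of the recurrence at \<open>\<lambda>\<close> are in \<open>\<ell>\<^sup>2\<close>. The solution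
  with \<open>u\<^sub>-\<^sub>1 = 0\<close>, \<open>u\<^sub>0 = e\<close> is an eigenvector, which is impossible for a symmetric \<open>J\<close> if \<open>\<lambda>\<close> is
  not real; for real \<open>\<lambda>\<close>, the solution \<open>v\<close> with \<open>v\<^sub>-\<^sub>1 = e\<close>, \<open>v\<^sub>0 = 0\<close> satisfies
  \<open>J v = \<lambda> v + \<delta>\<^sub>0 e\<close>, so that \<open>\<langle>J u, v\<rangle> - \<langle>u, J v\<rangle> = - \<parallel>e\<parallel>\<^sup>2 \<noteq> 0\<close>.\<close>

section \<open>The Hermitian inner product and the operator norm\<close>

text \<open>The summand of \<open>ell2_inner\<close>: linear in the first argument, conjugate-linear
  in the second.\<close>

definition hinner :: "complex^'d \<Rightarrow> complex^'d \<Rightarrow> complex" where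
  "hinner x y = (\<Sum>i\<in>UNIV. x $ i * cnj (y $ i))"

lemma hinner_add_left: "hinner (x + y) z = hinner x z + hinner y z"
  by (simp add: hinner_def sum.distrib algebra_simps)

lemma hinner_add_right: "hinner x (y + z) = hinner x y + hinner x z"
  by (simp add: hinner_def sum.distrib algebra_simps)

lemma hinner_diff_right: "hinner x (y - z) = hinner x y - hinner x z"
  by (simp add: hinner_def sum_subtractf algebra_simps)

lemma hinner_scale_left: "hinner (c *s x) y = c * hinner x y"
  by (simp add: hinner_def sum_distrib_left algebra_simps)

lemma hinner_scale_right: "hinner x (c *s y) = cnj c * hinner x y"
  by (simp add: hinner_def sum_distrib_left algebra_simps)

lemma hinner_zero_left [simp]: "hinner 0 y = 0"
  by (simp add: hinner_def)

lemma hinner_zero_right [simp]: "hinner x 0 = 0"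
  by (simp add: hinner_def)

lemma hinner_self: "hinner x x = of_real ((norm x)\<^sup>2)"
  by (simp add: hinner_def norm_vec_def L2_set_def sum_nonneg complex_norm_square
      del: of_real_power)

lemma hinner_self_eq_0_iff [simp]: "hinner x x = 0 \<longleftrightarrow> x = 0"
  by (simp add: hinner_self)

lemma norm_hinner_le: "norm (hinner x y) \<le> norm x * norm y"
proof -
  have "norm (hinner x y) \<le> (\<Sum>i\<in>UNIV. \<bar>norm (x $ i)\<bar> * \<bar>norm (y $ i)\<bar>)"
    unfolding hinner_def by (rule order_trans[OF norm_sum]) (simp add: norm_mult)
  also have "\<dots> \<le> norm x * norm y"
    unfolding norm_vec_def by (rule L2_set_mult_ineq)
  finally show ?thesis .
qed

lemma hinner_mult_left: "hinner (M *v x) y = hinner x (conj_transpose M *v y)"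
proof -
  have "hinner (M *v x) y = (\<Sum>i\<in>UNIV. \<Sum>j\<in>UNIV. M $ i $ j * x $ j * cnj (y $ i))"
    by (simp add: hinner_def matrix_vector_mult_def sum_distrib_right)
  also have "\<dots> = (\<Sum>j\<in>UNIV. \<Sum>i\<in>UNIV. M $ i $ j * x $ j * cnj (y $ i))"
    by (rule sum.swap)
  also have "\<dots> = hinner x (conj_transpose M *v y)"
    by (simp add: hinner_def matrix_vector_mult_def conj_transpose_def sum_distrib_left mult_ac)
  finally show ?thesis .
qed

lemma conj_transpose_idem [simp]: "conj_transpose (conj_transpose M) = M"
  by (simp add: conj_transpose_def vec_eq_iff)

lemma norm_mult_le_opnorm: "norm (M *v x) \<le> opnorm M * norm x"
  unfolding opnorm_def by (rule onorm) simp

lemma opnorm_nonneg: "0 \<le> opnorm M"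
  unfolding opnorm_def by (rule onorm_pos_le) simp

lemma mult_matrix_inv_vec:
  fixes M :: "complex^'n^'n"
  assumes "det M \<noteq> 0"
  shows "M *v (matrix_inv M *v x) = x"
proof -
  have "\<exists>M'. M ** M' = mat 1 \<and> M' ** M = mat 1"
    using assms by (simp add: invertible_def flip: invertible_det_nz)
  then have "M ** matrix_inv M = mat 1"
    unfolding matrix_inv_def by (rule someI2_ex) blast
  then show ?thesis
    by (simp add: matrix_vector_mul_assoc)
qed

lemma opnorm_pos:
  assumes "det M \<noteq> 0"
  shows "0 < opnorm M"
proof -
  \<comment> \<open>A nonzero vector in the range rules out \<open>opnorm M = 0\<close>; the
    all-ones vector \<open>1\<close> is such a vector because \<open>M\<close> is
    invertible.\<close>
  have "M *v (matrix_inv M *v 1) = 1"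
    using assms by (rule mult_matrix_inv_vec)
  moreover have "(1 :: complex^'a) \<noteq> 0"
    by (simp add: vec_eq_iff)
  ultimately have "opnorm M \<noteq> 0"
    using norm_mult_le_opnorm[of M "matrix_inv M *v 1"] by auto
  then show ?thesis
    using opnorm_nonneg[of M] by linarith
qed

section \<open>Square-summable sequences\<close>

lemma summable_norm_mult_ell2:
  assumes "u \<in> ell2" "v \<in> ell2"
  shows "summable (\<lambda>n. norm (u n) * norm (v n))"
proof (rule summable_comparison_test)
  show "summable (\<lambda>n. (norm (u n))\<^sup>2 + (norm (v n))\<^sup>2)"
    using assms by (intro summable_add) (auto simp: ell2_def)
  have "a * b \<le> a\<^sup>2 + b\<^sup>2" if "0 \<le> a" "0 \<le> b" for a b :: real
    using sum_squares_bound[of a b] mult_nonneg_nonneg[OF that] by linarith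
  then show "\<exists>N. \<forall>n\<ge>N. norm (norm (u n) * norm (v n)) \<le> (norm (u n))\<^sup>2 + (norm (v n))\<^sup>2"
    by simp
qed

lemma summable_hinner:
  assumes "u \<in> ell2" "v \<in> ell2"
  shows "summable (\<lambda>n. hinner (u n) (v n))"
  using summable_norm_mult_ell2[OF assms]
  by (rule summable_comparison_test') (rule norm_hinner_le)

lemma ell2_Suc: "u \<in> ell2 \<Longrightarrow> (\<lambda>n. u (Suc n)) \<in> ell2"
  by (simp add: ell2_def summable_Suc_iff[of "\<lambda>n. (norm (u n))\<^sup>2"])

lemma ell2_inner_eq_suminf: "ell2_inner u v = (\<Sum>n. hinner (u n) (v n))"
  by (simp add: ell2_inner_def hinner_def)

lemma finite_support_in_ell2:
  assumes "\<And>n. n \<ge> N \<Longrightarrow> u n = 0"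
  shows "u \<in> ell2"
  unfolding ell2_def mem_Collect_eq
  by (rule summable_finite[of "{..<N}"]) (simp_all add: assms)

section \<open>Block Jacobi operators\<close>

lemma jacobi_expr_0: "jacobi_expr A B u 0 = B 0 *v u 0 + A 0 *v u 1"
  and jacobi_expr_Suc: "jacobi_expr A B u (Suc n) =
    conj_transpose (A n) *v u n + B (Suc n) *v u (Suc n) + A (Suc n) *v u (Suc (Suc n))"
  by (simp_all add: jacobi_expr_def)

section \<open>Green's formula\<close>

lemma hinner_hermitian:
  assumes "M = conj_transpose M"
  shows "hinner (M *v x) y = hinner x (M *v y)"
  by (metis assms hinner_mult_left)

text \<open>Summation by parts: the \<open>B\<close> terms cancel because \<open>B\<close> is
  Hermitian, and the off-diagonal terms telescope because \<open>A k\<close> and its conjugate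
  transpose are adjoint. Only the coupling between sites \<open>n\<close> and \<open>Suc n\<close>
  is left.\<close>

lemma jacobi_green:
  assumes "\<And>n. B n = conj_transpose (B n)"
  shows "(\<Sum>k<Suc n. hinner (jacobi_expr A B u k) (v k) - hinner (u k) (jacobi_expr A B v k))
    = hinner (A n *v u (Suc n)) (v n) - hinner (u n) (A n *v v (Suc n))"
proof (induction n)
  case 0
  show ?case
    by (simp add: jacobi_expr_0 hinner_add_left hinner_add_right hinner_hermitian[of "B _", OF assms])
next
  case (Suc n)
  show ?case
    by (subst sum.lessThan_Suc, subst Suc.IH)
      (simp add: jacobi_expr_Suc hinner_add_left hinner_add_right hinner_hermitian[of "B _", OF assms]
        hinner_mult_left[of "A n"] hinner_mult_left[of "conj_transpose (A n)"])
qed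

section \<open>Finitely supported sequences and density of the domain\<close>

lemma jacobi_expr_finite_support:
  assumes "\<And>n. n \<ge> N \<Longrightarrow> u n = 0" and "n \<ge> Suc N"
  shows "jacobi_expr A B u n = 0"
  using assms by (cases n) (simp_all add: jacobi_expr_Suc)

lemma finite_support_in_jacobi_operator:
  assumes "\<And>n. n \<ge> N \<Longrightarrow> u n = 0"
  shows "(u, jacobi_expr A B u) \<in> jacobi_operator A B"
  using finite_support_in_ell2[of N u] assms
    finite_support_in_ell2[of "Suc N" "jacobi_expr A B u"]
    jacobi_expr_finite_support[of N u]
  by (simp add: jacobi_operator_def)

lemma densely_defined_jacobi_operator: "densely_defined (jacobi_operator A B)"
  unfolding densely_defined_def
proof (intro ballI allI impI)
  fix u :: "nat \<Rightarrow> complex^'a" and e :: real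
  assume u: "u \<in> ell2" and e: "0 < e"
  define f where "f n = (norm (u n))\<^sup>2" for n
  have f: "summable f"
    using u by (simp add: ell2_def f_def[abs_def])
  obtain N where N: "norm (\<Sum>i. f (i + N)) < e\<^sup>2"
    using suminf_exist_split[OF _ f, of "e\<^sup>2"] e by auto
  \<comment> \<open>Truncation leaves an error equal to the tail of the convergent series
    \<open>f\<close>.\<close>
  define v where "v n = (if n < N then u n else 0)" for n
  have "(\<lambda>n. (norm (u n - v n))\<^sup>2) = (\<lambda>n. if n < N then 0 else f n)"
    by (auto simp: v_def f_def)
  moreover have "(\<lambda>n. if n < N then 0 else f n) sums (\<Sum>i. f (i + N))"
  proof (subst sums_iff_shift'[of _ N, symmetric])
    have "(\<lambda>i. f (i + N)) sums (\<Sum>i. f (i + N))"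
      using f by (simp add: summable_sums summable_iff_shift)
    then show "(\<lambda>i. if i + N < N then 0 else f (i + N)) sums
        ((\<Sum>i. f (i + N)) - (\<Sum>i<N. if i < N then 0 else f i))"
      by simp
  qed
  ultimately have "(\<Sum>n. (norm (u n - v n))\<^sup>2) = (\<Sum>i. f (i + N))"
    by (simp add: sums_unique[symmetric])
  then have "ell2_norm (\<lambda>n. u n - v n) < sqrt (e\<^sup>2)"
    unfolding ell2_norm_def using N by (intro real_sqrt_less_mono) simp
  then have "ell2_norm (\<lambda>n. u n - v n) < e"
    using e by simp
  moreover have "v \<in> Domain (jacobi_operator A B)"
    using finite_support_in_jacobi_operator[of N v A B] by (auto simp: v_def)
  ultimately show "\<exists>v\<in>Domain (jacobi_operator A B). ell2_norm (\<lambda>n. u n - v n) < e"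
    by blast
qed

text \<open>Sequences supported at one site lie in the domain, and testing against them determines
  each entry of \<open>w\<close>.\<close>

lemma adjoint_jacobi_operator_subset:
  assumes B: "\<And>n. B n = conj_transpose (B n)"
  shows "adjoint_operator (jacobi_operator A B) \<subseteq> jacobi_operator A B"
proof clarify
  fix v w assume vw: "(v, w) \<in> adjoint_operator (jacobi_operator A B)"
  have "w n = jacobi_expr A B v n" for n
  proof -
    \<comment> \<open>Placing the discrepancy \<open>x\<close> itself at site \<open>n\<close> turns
      the adjoint identity into \<open>hinner x x = 0\<close>.\<close>
    define x where "x = w n - jacobi_expr A B v n"
    define u where "u k = (if k = n then x else 0)" for k
    have u0: "u k = 0" if "k \<ge> Suc n" for k
      using that by (simp add: u_def)
    have Ju0: "jacobi_expr A B u k = 0" if "k \<ge> Suc (Suc n)" for k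
      using jacobi_expr_finite_support[of "Suc n" u k] u0 that by blast
    have at_n: "(\<Sum>k. hinner (u k) (g k)) = hinner x (g n)"
      "(\<Sum>k<Suc (Suc n). hinner (u k) (g k)) = hinner x (g n)" for g
    proof -
      have *: "hinner (u k) (g k) = (if k = n then hinner x (g n) else 0)" for k
        by (simp add: u_def)
      show "(\<Sum>k. hinner (u k) (g k)) = hinner x (g n)"
        unfolding * by (rule sums_unique[symmetric, OF sums_single])
      show "(\<Sum>k<Suc (Suc n). hinner (u k) (g k)) = hinner x (g n)"
        unfolding * by (simp add: sum.delta)
    qed
    \<comment> \<open>The cut is after site \<open>Suc n\<close>, the last one that
      \<open>jacobi_expr A B u\<close> can reach; there both boundary terms contain a vanishing
      entry of \<open>u\<close>.\<close>
    have "(\<Sum>k<Suc (Suc n). hinner (jacobi_expr A B u k) (v k) - hinner (u k) (jacobi_expr A B v k)) = 0"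
      using jacobi_green[where B = B, OF B, where n = "Suc n" and u = u and v = v and A = A] u0 by simp
    then have "(\<Sum>k<Suc (Suc n). hinner (jacobi_expr A B u k) (v k)) = hinner x (jacobi_expr A B v n)"
      unfolding sum_subtractf at_n by simp
    moreover have "(\<Sum>k. hinner (jacobi_expr A B u k) (v k))
        = (\<Sum>k<Suc (Suc n). hinner (jacobi_expr A B u k) (v k))"
      by (rule suminf_finite) (auto simp: not_less Ju0)
    moreover have "ell2_inner (jacobi_expr A B u) v = ell2_inner u w"
      using vw finite_support_in_jacobi_operator[of "Suc n" u A B, OF u0]
      by (auto simp: adjoint_operator_def)
    ultimately have "hinner x x = 0"
      by (simp add: ell2_inner_eq_suminf at_n x_def hinner_diff_right)
    then show ?thesis
      by (simp add: x_def)
  qed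
  then have "w = jacobi_expr A B v"
    by blast
  then show "(v, w) \<in> jacobi_operator A B"
    using vw by (simp add: adjoint_operator_def jacobi_operator_def)
qed

section \<open>The Carleman condition\<close>

lemma carleman_iff_not_summable: "carleman A \<longleftrightarrow> \<not> summable (\<lambda>n. 1 / opnorm (A n))"
proof
  show "\<not> summable (\<lambda>n. 1 / opnorm (A n))" if "carleman A"
    using that suminf_ereal_finite[of "\<lambda>n. 1 / opnorm (A n)"] by (auto simp: carleman_def)
  show "carleman A" if "\<not> summable (\<lambda>n. 1 / opnorm (A n))"
    using that summable_ereal[of "\<lambda>n. 1 / opnorm (A n)"] opnorm_nonneg
    by (auto simp: carleman_def)
qed

lemma carleman_imp_symmetric:
  assumes det: "\<And>n. det (A n) \<noteq> 0"
    and B: "\<And>n. B n = conj_transpose (B n)"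
    and carleman: "carleman A"
    and u: "u \<in> ell2" "jacobi_expr A B u \<in> ell2"
    and v: "v \<in> ell2" "jacobi_expr A B v \<in> ell2"
  shows "ell2_inner (jacobi_expr A B u) v = ell2_inner u (jacobi_expr A B v)"
proof (rule ccontr)
  assume neq: "\<not> ?thesis"
  define D where "D = ell2_inner (jacobi_expr A B u) v - ell2_inner u (jacobi_expr A B v)"
  define W where "W n = hinner (A n *v u (Suc n)) (v n) - hinner (u n) (A n *v v (Suc n))" for n
  define s where "s n = norm (u (Suc n)) * norm (v n) + norm (u n) * norm (v (Suc n))" for n
  have "(\<lambda>k. hinner (jacobi_expr A B u k) (v k) - hinner (u k) (jacobi_expr A B v k)) sums D"
    unfolding D_def ell2_inner_eq_suminf
    using u v by (intro sums_diff summable_sums summable_hinner)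
  then have "(\<lambda>n. \<Sum>k<Suc n. hinner (jacobi_expr A B u k) (v k) - hinner (u k) (jacobi_expr A B v k))
      \<longlonglongrightarrow> D"
    unfolding sums_def by (rule LIMSEQ_Suc)
  then have "W \<longlonglongrightarrow> D"
    unfolding jacobi_green[where B = B, OF B] W_def .
  then have "(\<lambda>n. norm (W n)) \<longlonglongrightarrow> norm D"
    by (rule tendsto_norm)
  moreover have D: "0 < norm D"
    using neq by (simp add: D_def)
  \<comment> \<open>Half of the nonzero limit is a lower bound for almost all
    \<open>norm (W n)\<close>; it gives the factor \<open>2 / norm D\<close> below.\<close>
  ultimately have "\<forall>\<^sub>F n in sequentially. norm D / 2 < norm (W n)"
    by (intro order_tendstoD) auto
  moreover have "norm (W n) \<le> opnorm (A n) * s n" for n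
  proof -
    have "norm (W n) \<le> norm (A n *v u (Suc n)) * norm (v n) + norm (u n) * norm (A n *v v (Suc n))"
      unfolding W_def by (intro order_trans[OF norm_triangle_ineq4] add_mono norm_hinner_le)
    also have "\<dots> \<le> (opnorm (A n) * norm (u (Suc n))) * norm (v n)
        + norm (u n) * (opnorm (A n) * norm (v (Suc n)))"
      by (intro add_mono mult_right_mono mult_left_mono norm_mult_le_opnorm) auto
    finally show ?thesis
      by (simp add: s_def algebra_simps)
  qed
  ultimately have "\<forall>\<^sub>F n in sequentially. norm (1 / opnorm (A n)) \<le> 2 / norm D * s n"
  proof (elim eventually_mono)
    fix n
    assume "norm D / 2 < norm (W n)" and "\<And>n. norm (W n) \<le> opnorm (A n) * s n"
    then have "norm D / 2 \<le> opnorm (A n) * s n"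
      by (meson less_imp_le order_trans)
    then show "norm (1 / opnorm (A n)) \<le> 2 / norm D * s n"
      using D opnorm_pos[OF det[of n]] by (simp add: field_simps)
  qed
  moreover have "summable (\<lambda>n. 2 / norm D * s n)"
    unfolding s_def using u v
    by (intro summable_mult summable_add summable_norm_mult_ell2 ell2_Suc)
  ultimately have "summable (\<lambda>n. 1 / opnorm (A n))"
    by (rule summable_comparison_test_ev)
  then show False
    using carleman by (simp add: carleman_iff_not_summable)
qed

theorem carleman_imp_self_adjoint:
  assumes "\<And>n. det (A n) \<noteq> 0" and "\<And>n. B n = conj_transpose (B n)" and "carleman A"
  shows "self_adjoint (jacobi_operator A B)"
  unfolding self_adjoint_def
proof (intro conjI densely_defined_jacobi_operator equalityI
    adjoint_jacobi_operator_subset[OF assms(2)])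
  show "jacobi_operator A B \<subseteq> adjoint_operator (jacobi_operator A B)"
    using carleman_imp_symmetric[OF assms]
    by (auto simp: jacobi_operator_def adjoint_operator_def)
qed

section \<open>Solutions of the recurrence\<close>

text \<open>The state \<open>(u_{n-1}, u_n)\<close> on which the transfer matrices act;
  \<open>upper\<close> and \<open>lower\<close> recover its two entries.\<close>

definition block_vec :: "complex^'d \<Rightarrow> complex^'d \<Rightarrow> complex^('d + 'd)" where
  "block_vec x y = (\<chi> i. case i of Inl a \<Rightarrow> x $ a | Inr a \<Rightarrow> y $ a)"

definition upper :: "complex^('d + 'd) \<Rightarrow> complex^'d" where
  "upper x = (\<chi> i. x $ Inl i)"

definition lower :: "complex^('d + 'd) \<Rightarrow> complex^'d" where
  "lower x = (\<chi> i. x $ Inr i)"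

lemma upper_block_vec [simp]: "upper (block_vec x y) = x"
  and lower_block_vec [simp]: "lower (block_vec x y) = y"
  by (simp_all add: upper_def lower_def block_vec_def vec_eq_iff)

lemma sum_UNIV_Plus:
  "sum f (UNIV :: ('a::finite + 'b::finite) set) = (\<Sum>a\<in>UNIV. f (Inl a)) + (\<Sum>b\<in>UNIV. f (Inr b))"
  using sum.Plus[of "UNIV :: 'a set" "UNIV :: 'b set" f] by (simp add: o_def)

lemma upper_block_matrix_mult:
    "upper (block_matrix P Q R S *v x) = P *v upper x + Q *v lower x"
  and lower_block_matrix_mult:
    "lower (block_matrix P Q R S *v x) = R *v upper x + S *v lower x"
  by (simp_all add: upper_def lower_def block_matrix_def matrix_vector_mult_def sum_UNIV_Plus
      vec_eq_iff)

lemma norm_lower_le: "norm (lower x) \<le> norm x"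
  unfolding norm_vec_def L2_set_def
  by (rule real_sqrt_le_mono) (simp add: sum_UNIV_Plus lower_def sum_nonneg)

lemma mat_mult_vec: "mat c *v x = c *s x" for x :: "complex^'d"
  by (simp add: vec_eq_iff matrix_vector_mult_def mat_def if_distrib[of "\<lambda>t. t * _"] cong: if_cong)

lemma uminus_mult_vec: "(- M) *v x = - (M *v x)" for M :: "complex^'n^'m"
  by (simp add: vec_eq_iff matrix_vector_mult_def sum_negf)

text \<open>The initial state is \<open>u_{-1} = f\<close>, \<open>u_0 = e\<close>; after
  \<open>n\<close> transfer steps the lower half is \<open>u_n\<close>.\<close>

definition solution ::
  "(nat \<Rightarrow> complex^'d^'d) \<Rightarrow> (nat \<Rightarrow> complex^'d^'d) \<Rightarrow> complex \<Rightarrow> complex^'d \<Rightarrow> complex^'d \<Rightarrow>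
    nat \<Rightarrow> complex^'d" where
  "solution A B z f e n = lower (transfer_prod A B n z *v block_vec f e)"

lemma solution_0 [simp]: "solution A B z f e 0 = e"
  by (simp add: solution_def)

lemma upper_transfer_prod_Suc:
  "upper (transfer_prod A B (Suc n) z *v block_vec f e) = solution A B z f e n"
  by (simp add: solution_def transfer_matrix_def upper_block_matrix_mult
      matrix_vector_mul_assoc[symmetric])

text \<open>The lower row of the transfer matrix multiplied by \<open>A n\<close>. The
  \<open>upper\<close> term stands for \<open>u_{n-1}\<close>, so that \<open>n = 0\<close> is
  covered.\<close>

lemma mult_solution_Suc:
  assumes "det (A n) \<noteq> 0"
  shows "A n *v solution A B z f e (Suc n) = z *s solution A B z f e n - B n *v solution A B z f e n
    - conj_transpose (A_pred A n) *v upper (transfer_prod A B n z *v block_vec f e)"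
  by (simp add: solution_def transfer_matrix_def lower_block_matrix_mult uminus_mult_vec
      matrix_vector_mul_assoc[symmetric] matrix_vector_mult_diff_rdistrib mat_mult_vec
      matrix_vector_right_distrib matrix_vector_mult_diff_distrib mult_matrix_inv_vec[OF assms])

lemma conj_transpose_uminus_mat_1: "conj_transpose (- mat 1) = - mat 1"
  by (simp add: conj_transpose_def mat_def vec_eq_iff)

text \<open>At site 0 the recurrence has the extra term \<open>-f\<close>, coming from
  \<open>A_pred A 0 = - mat 1\<close>, which \<open>jacobi_expr\<close> lacks; hence the source
  \<open>f\<close> there.\<close>

lemma jacobi_expr_solution:
  assumes "\<And>n. det (A n) \<noteq> 0"
  shows "jacobi_expr A B (solution A B z f e) n
    = z *s solution A B z f e n + (if n = 0 then f else 0)"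
proof (cases n)
  case 0
  then show ?thesis
    using mult_solution_Suc[where A = A and n = 0, OF assms, of B z f e]
    by (simp add: jacobi_expr_0 A_pred_def conj_transpose_uminus_mat_1 uminus_mult_vec)
next
  case (Suc m)
  then show ?thesis
    by (simp add: jacobi_expr_Suc mult_solution_Suc[where A = A, OF assms] A_pred_def
        upper_transfer_prod_Suc del: transfer_prod.simps)
qed

section \<open>Square-summable solutions\<close>

lemma solution_in_ell2:
  assumes "summable (\<lambda>k. (opnorm (transfer_prod A B k z))\<^sup>2)"
  shows "solution A B z f e \<in> ell2"
proof -
  have "norm (solution A B z f e k) \<le> opnorm (transfer_prod A B k z) * norm (block_vec f e)" for k
    unfolding solution_def by (rule order_trans[OF norm_lower_le norm_mult_le_opnorm])
  then have "norm ((norm (solution A B z f e k))\<^sup>2)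
      \<le> (opnorm (transfer_prod A B k z))\<^sup>2 * (norm (block_vec f e))\<^sup>2" for k
    by (simp add: power_mono flip: power_mult_distrib)
  then show ?thesis
    unfolding ell2_def mem_Collect_eq
    by (rule summable_comparison_test'[OF summable_mult2[OF assms]])
qed

lemma jacobi_expr_solution_in_ell2:
  assumes det: "\<And>n. det (A n) \<noteq> 0"
    and summable: "summable (\<lambda>k. (opnorm (transfer_prod A B k z))\<^sup>2)"
  shows "jacobi_expr A B (solution A B z f e) \<in> ell2"
proof -
  have "norm (z *s x) = norm z * norm x" for x :: "complex^'a"
    by (simp add: norm_vec_def norm_mult L2_set_right_distrib)
  \<comment> \<open>From index 1 on the source term is absent and the sequence is \<open>z\<close>
    times the solution.\<close>
  then have "summable (\<lambda>n. (norm (jacobi_expr A B (solution A B z f e) (Suc n)))\<^sup>2)"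
    using ell2_Suc[OF solution_in_ell2[OF summable, of f e]]
    by (auto simp: jacobi_expr_solution[where A = A, OF det] ell2_def power_mult_distrib
        intro!: summable_mult)
  then show ?thesis
    by (simp add: ell2_def
        summable_Suc_iff[of "\<lambda>n. (norm (jacobi_expr A B (solution A B z f e) n))\<^sup>2"])
qed

text \<open>Each source acts only at site 0, where it is paired with the initial value
  \<open>h\<close> or \<open>e\<close> of the other solution.\<close>

lemma ell2_inner_jacobi_solution:
  assumes det: "\<And>n. det (A n) \<noteq> 0"
    and summable: "summable (\<lambda>k. (opnorm (transfer_prod A B k z))\<^sup>2)"
  defines "u \<equiv> solution A B z"
  shows "ell2_inner (jacobi_expr A B (u f e)) (u g h) = z * ell2_inner (u f e) (u g h) + hinner f h"
    and "ell2_inner (u f e) (jacobi_expr A B (u g h))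
      = cnj z * ell2_inner (u f e) (u g h) + hinner e g"
proof -
  have *: "(\<lambda>n. hinner (u f e n) (u g h n)) sums ell2_inner (u f e) (u g h)"
    unfolding ell2_inner_eq_suminf u_def
    by (intro summable_sums summable_hinner solution_in_ell2 summable)
  have "(\<lambda>n. z * hinner (u f e n) (u g h n) + (if n = 0 then hinner f (u g h n) else 0)) sums
      (z * ell2_inner (u f e) (u g h) + hinner f (u g h 0))"
    by (intro sums_add sums_mult * sums_single)
  then show "ell2_inner (jacobi_expr A B (u f e)) (u g h) = z * ell2_inner (u f e) (u g h) + hinner f h"
    unfolding ell2_inner_eq_suminf[of "jacobi_expr A B (u f e)"]
    by (intro sums_unique[symmetric])
      (simp add: u_def jacobi_expr_solution[where A = A, OF det] hinner_add_left hinner_scale_left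
        if_distrib[of "\<lambda>x. hinner x _"] cong: if_cong)
  have "(\<lambda>n. cnj z * hinner (u f e n) (u g h n) + (if n = 0 then hinner (u f e n) g else 0)) sums
      (cnj z * ell2_inner (u f e) (u g h) + hinner (u f e 0) g)"
    by (intro sums_add sums_mult * sums_single)
  then show "ell2_inner (u f e) (jacobi_expr A B (u g h))
      = cnj z * ell2_inner (u f e) (u g h) + hinner e g"
    unfolding ell2_inner_eq_suminf[of _ "jacobi_expr A B (u g h)"]
    by (intro sums_unique[symmetric])
      (simp add: u_def jacobi_expr_solution[where A = A, OF det] hinner_add_right hinner_scale_right
        if_distrib[of "\<lambda>x. hinner _ x"] cong: if_cong)
qed

lemma ell2_inner_self_neq_0:
  assumes "u \<in> ell2" "u n \<noteq> 0"
  shows "ell2_inner u u \<noteq> 0"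
proof -
  have s: "summable (\<lambda>n. (norm (u n))\<^sup>2)"
    using assms by (simp add: ell2_def)
  have "0 < (\<Sum>n. (norm (u n))\<^sup>2)"
    using assms by (intro suminf_pos2[OF s, of n]) auto
  then show ?thesis
    unfolding ell2_inner_eq_suminf hinner_self
    by (simp add: suminf_of_real[OF s, symmetric] del: of_real_power)
qed

theorem summable_transfer_prod_imp_not_self_adjoint:
  assumes det: "\<And>n. det (A n) \<noteq> 0"
    and summable: "summable (\<lambda>k. (opnorm (transfer_prod A B k z))\<^sup>2)"
  shows "\<not> self_adjoint (jacobi_operator A B)"
proof
  assume "self_adjoint (jacobi_operator A B)"
  then have adj: "adjoint_operator (jacobi_operator A B) = jacobi_operator A B"
    by (simp add: self_adjoint_def)
  define u where "u = solution A B z"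
  have sym: "z * ell2_inner (u f e) (u g h) + hinner f h
      = cnj z * ell2_inner (u f e) (u g h) + hinner e g" for f e g h
  proof -
    have J: "(u f e, jacobi_expr A B (u f e)) \<in> jacobi_operator A B" for f e
      unfolding u_def jacobi_operator_def
      using solution_in_ell2[OF summable] jacobi_expr_solution_in_ell2[where A = A, OF det summable]
      by blast
    have "(u g h, jacobi_expr A B (u g h)) \<in> adjoint_operator (jacobi_operator A B)"
      unfolding adj by (rule J)
    then have "ell2_inner (jacobi_expr A B (u f e)) (u g h) = ell2_inner (u f e) (jacobi_expr A B (u g h))"
      using J[of f e] by (auto simp: adjoint_operator_def)
    then show ?thesis
      unfolding u_def ell2_inner_jacobi_solution[where A = A, OF det summable] .
  qed
  have "ell2_inner (u 0 1) (u 0 1) \<noteq> 0"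
    using ell2_inner_self_neq_0[OF solution_in_ell2[OF summable, of 0 1], of 0]
    by (simp add: u_def)
  \<comment> \<open>With both sources zero, \<open>u 0 1\<close> is an eigenvector, so symmetry
    forces a real eigenvalue.\<close>
  then have "z = cnj z"
    using sym[of 0 1 0 1] by simp
  \<comment> \<open>For real \<open>z\<close> the terms with \<open>z\<close> cancel; pairing
    \<open>u 0 1\<close> with \<open>u 1 0\<close> leaves only the source contribution
    \<open>hinner 1 1\<close>.\<close>
  then have "hinner (1 :: complex^'a) 1 = 0"
    using sym[of 0 1 1 0] by simp
  then show False
    by simp
qed

text \<open>A finite lim inf bounds the quotients only for arbitrarily large \<open>n\<close>, but
  partial sums of nonnegative terms increase, so this bounds all of them. Positivity of
  \<open>r\<close> starts at index 1 because \<open>rho A 0 = 0\<close>.\<close>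

lemma summable_of_liminf_finite:
  fixes a r :: "nat \<Rightarrow> real"
  assumes a: "\<And>k. 0 \<le> a k"
    and r: "\<And>n. 0 < n \<Longrightarrow> 0 < r n" "\<And>n. r n \<le> R"
    and liminf: "liminf (\<lambda>n. ereal (1 / r n * (\<Sum>k=1..n. a k))) < \<infinity>"
  shows "summable a"
proof -
  obtain C where "liminf (\<lambda>n. ereal (1 / r n * (\<Sum>k=1..n. a k))) < ereal C"
    using ereal_dense2[OF liminf] by blast
  then have "\<not> (\<forall>\<^sub>F n in sequentially. ereal C \<le> ereal (1 / r n * (\<Sum>k=1..n. a k)))"
    using Liminf_bounded[of "ereal C" "\<lambda>n. ereal (1 / r n * (\<Sum>k=1..n. a k))" sequentially]
    by (auto simp del: ereal_less_eq simp: not_le[symmetric])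
  then have freq: "\<exists>n\<ge>N. 1 / r n * (\<Sum>k=1..n. a k) < C" for N
    by (auto simp: eventually_sequentially not_le)
  \<comment> \<open>The term \<open>a 0\<close> is added since the averaged sums start at 1; the
    absolute value makes the sign of \<open>C\<close> irrelevant.\<close>
  have "(\<Sum>k\<le>N. a k) \<le> a 0 + \<bar>C\<bar> * R" for N
  proof -
    obtain n where n: "n \<ge> Suc N" and "1 / r n * (\<Sum>k=1..n. a k) < C"
      using freq by blast
    then have "(\<Sum>k=1..n. a k) \<le> C * r n"
      using r(1)[of n] by (simp add: field_simps)
    also have "\<dots> \<le> \<bar>C\<bar> * R"
      using r(1)[of n] r(2)[of n] n by (intro mult_mono) auto
    finally have "(\<Sum>k=1..n. a k) \<le> \<bar>C\<bar> * R" .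
    moreover have "(\<Sum>k\<le>N. a k) \<le> (\<Sum>k\<in>insert 0 {1..n}. a k)"
      using n a by (intro sum_mono2) auto
    ultimately show ?thesis
      by simp
  qed
  then show ?thesis
    using a by (intro bounded_imp_summable)
qed

theorem proposition4p2:
  fixes A B :: "nat \<Rightarrow> complex^'d^'d"
    and G :: "complex set"
  assumes "\<And>n. det (A n) \<noteq> 0"
    and "\<And>n. B n = conj_transpose (B n)"
    and "G \<noteq> {}"
    and "\<And>z. z \<in> G \<Longrightarrow>
      liminf (\<lambda>n. ereal (1 / rho A n * (\<Sum>k=1..n. (opnorm (transfer_prod A B k z))\<^sup>2))) < \<infinity>"
  shows "self_adjoint (jacobi_operator A B) \<longleftrightarrow> carleman A"
proof
  show "self_adjoint (jacobi_operator A B)" if "carleman A"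
    using assms(1,2) that by (rule carleman_imp_self_adjoint)
  show "carleman A" if sa: "self_adjoint (jacobi_operator A B)"
  proof (rule ccontr)
    assume "\<not> carleman A"
    then have s: "summable (\<lambda>n. 1 / opnorm (A n))"
      by (simp add: carleman_iff_not_summable)
    obtain z where "z \<in> G"
      using assms(3) by blast
    have "summable (\<lambda>k. (opnorm (transfer_prod A B k z))\<^sup>2)"
    proof (rule summable_of_liminf_finite[OF _ _ _ assms(4)[OF \<open>z \<in> G\<close>]])
      show "0 < rho A n" if "0 < n" for n
        unfolding rho_def using that by (intro sum_pos) (auto simp: opnorm_pos assms(1))
      \<comment> \<open>The full sum of the convergent series serves as the bound
        \<open>R\<close>.\<close>
      show "rho A n \<le> (\<Sum>k. 1 / opnorm (A k))" for n
        unfolding rho_def using s by (rule sum_le_suminf) (auto simp: opnorm_nonneg)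
    qed simp
    then show False
      using summable_transfer_prod_imp_not_self_adjoint[where A = A, OF assms(1)] sa by blast
  qed
qed

end
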